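(* Let $\{X_n;f_n^{n+1}\}_{n\in\mathbb{N}}$ be an inverse sequence of countable spaces with analytic topology, and let $X_\infty$ be its inverse limit. If $X_n$ is a $q^+$ space for each $n\in\mathbb{N}$, then every countable subspace of $X_\infty$ is a $q^+$ space.
   Context: An inverse sequence $\{X_n;f_n^{n+1}\}_{n\in\mathbb{N}}$ consists of topological spaces $X_n$ and continuous functions $f_n^{n+1}:X_{n+1}\to X_n$. Its inverse limit is the subspace $X_\infty=\{(x_n)_n\in\prod_n X_n:\ x_n=f_n^{n+1}(x_{n+1})\text{ for all }n\in\mathbb{N}\}$ of the product space $\prod_n X_n$. A topological space $X$ is a $q^+$ space if for all $A\subseteq X$, all $x\in\overline{A}$ and every partition $(F_n)_n$ of $A$ into finite sets, there is $S\subseteq A$ such that $x\in\overline{S}$ and $S\cap F_n$ has at most one element for each $n$. A subset of a Polish space is analytic if it is a continuous image of a Polish space. A topology $\tau$ on a countable set $X$ is analytic if $\tau$ is an analytic subset of the Cantor cube $2^X=\{0,1\}^X$, where subsets of $X$ are identified with their characteristic functions. *)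

theory Defs
  imports "HOL-Analysis.Analysis" "HOL-Library.Disjoint_Sets" "HOL-Library.Equipollence"
begin

text \<open>The underlying sets \<open>topspace (X n)\<close> may be different subsets of the common type, so taking
  all of them in one type is no restriction.\<close>

definition inverse_sequence :: "(nat \<Rightarrow> 'a topology) \<Rightarrow> (nat \<Rightarrow> 'a \<Rightarrow> 'a) \<Rightarrow> bool" where
  "inverse_sequence X f \<longleftrightarrow> (\<forall>n. continuous_map (X (Suc n)) (X n) (f n))"

definition inverse_limit :: "(nat \<Rightarrow> 'a topology) \<Rightarrow> (nat \<Rightarrow> 'a \<Rightarrow> 'a) \<Rightarrow> (nat \<Rightarrow> 'a) topology" where
  "inverse_limit X f =
     subtopology (product_topology X UNIV) {x. \<forall>n. x n = f n (x (Suc n))}"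

text \<open>The members of a partition \<open>F\<close> are allowed to be empty, so that finite sets can be
  partitioned as well.\<close>

definition q_plus_space :: "'a topology \<Rightarrow> bool" where
  "q_plus_space X \<longleftrightarrow>
     (\<forall>A x. \<forall>F :: nat \<Rightarrow> 'a set.
        A \<subseteq> topspace X \<and> x \<in> X closure_of A \<and>
        disjoint_family F \<and> (\<Union>n. F n) = A \<and> (\<forall>n. finite (F n)) \<longrightarrow>
        (\<exists>S. S \<subseteq> A \<and> x \<in> X closure_of S \<and> (\<forall>n. card (S \<inter> F n) \<le> 1)))"

definition Polish_space :: "'a topology \<Rightarrow> bool" where
  "Polish_space P \<longleftrightarrow> completely_metrizable_space P \<and> separable_space P"

text \<open>A definition cannot quantify over types, so the Polish space mapping onto \<open>A\<close> is carried by
  a set of reals. This loses nothing, since a Polish space has at most continuum many points; see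
  \<open>analytic_inI\<close> below.\<close>

definition analytic_in :: "'a topology \<Rightarrow> 'a set \<Rightarrow> bool" where
  "analytic_in Z A \<longleftrightarrow>
     (\<exists>(P :: real topology) g. Polish_space P \<and> continuous_map P Z g \<and> g ` topspace P = A)"

text \<open>The points of the cube are extensional functions (\<open>undefined\<close> outside \<open>I\<close>).\<close>

definition Cantor_cube :: "'a set \<Rightarrow> ('a \<Rightarrow> bool) topology" where
  "Cantor_cube I = product_topology (\<lambda>_. discrete_topology UNIV) I"

definition char_fun :: "'a set \<Rightarrow> 'a set \<Rightarrow> 'a \<Rightarrow> bool" where
  "char_fun I U = (\<lambda>x\<in>I. x \<in> U)"

definition analytic_topology :: "'a topology \<Rightarrow> bool" where
  "analytic_topology X \<longleftrightarrow>
     analytic_in (Cantor_cube (topspace X)) (char_fun (topspace X) ` {U. openin X U})"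

lemma Polish_space_lepoll_real:
  assumes "Polish_space P"
  shows "topspace P \<lesssim> (UNIV :: real set)"
proof -
  obtain M d where "Metric_space M d" and Pd: "P = Metric_space.mtopology M d"
    using assms unfolding Polish_space_def completely_metrizable_space_def by blast
  then interpret Metric_space M d by simp
  obtain C where C: "countable C" "C \<subseteq> M" "mtopology closure_of C = M"
    using assms unfolding Polish_space_def separable_space_def Pd by auto
  define b where "b x = {(c, n :: nat). c \<in> C \<and> d c x < inverse (Suc n)}" for x
  have "inj_on b M"
  proof (rule inj_onI, rule ccontr)
    fix x y assume xy: "x \<in> M" "y \<in> M" "b x = b y" "x \<noteq> y"
    then have "d x y / 2 > 0"
      by simp
    then obtain n where n: "inverse (real (Suc n)) < d x y / 2"
      using reals_Archimedean by blast
    have "x \<in> mtopology closure_of C"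
      using C(3) xy(1) by simp
    moreover have "inverse (real (Suc n)) > 0"
      by simp
    ultimately have "\<exists>c\<in>C. c \<in> mball x (inverse (real (Suc n)))"
      unfolding metric_closure_of by blast
    then obtain c where c: "c \<in> C" "d x c < inverse (real (Suc n))"
      by (auto simp del: of_nat_Suc)
    then have "(c, n) \<in> b x"
      by (simp add: b_def commute)
    then have "(c, n) \<in> b y"
      using xy(3) by simp
    then have "d c y < inverse (real (Suc n))"
      by (simp add: b_def)
    moreover have "d x y \<le> d x c + d c y"
      using triangle xy(1,2) c(1) C(2) by blast
    ultimately show False
      using c(2) n by linarith
  qed
  then have "topspace P \<lesssim> Pow (C \<times> (UNIV :: nat set))"
    unfolding lepoll_def Pd by (intro exI[of _ b]) (auto simp: b_def)
  also have "Pow (C \<times> (UNIV :: nat set)) \<lesssim> (UNIV :: nat set set)"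
  proof -
    have "countable (C \<times> (UNIV :: nat set))"
      using C(1) by (intro countable_SIGMA countableI_type)
    then obtain e :: "_ \<Rightarrow> nat" where "inj_on e (C \<times> (UNIV :: nat set))"
      unfolding countable_def by blast
    then show ?thesis
      unfolding lepoll_def by (intro exI[of _ "image e"]) (simp add: inj_on_image_Pow)
  qed
  also have "(UNIV :: nat set set) \<lesssim> (UNIV :: real set)"
    using nat_sets_eqpoll_reals eqpoll_imp_lepoll by blast
  finally show ?thesis .
qed

lemma analytic_inI:
  fixes P :: "'b topology"
  assumes P: "Polish_space P" and g: "continuous_map P Z g" and img: "g ` topspace P = A"
  shows "analytic_in Z A"
proof -
  obtain e :: "'b \<Rightarrow> real" where e: "inj_on e (topspace P)"
    using Polish_space_lepoll_real[OF P] unfolding lepoll_def by blast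
  define h where "h = inv_into (topspace P) e"
  define Q where "Q = pullback_topology (e ` topspace P) h P"
  have he: "h (e x) = x" if "x \<in> topspace P" for x
    using e that by (simp add: h_def)
  have topQ: "topspace Q = e ` topspace P"
    unfolding Q_def topspace_pullback_topology using he by auto
  have ch: "continuous_map Q P h"
    unfolding Q_def using continuous_map_pullback[of P P id "e ` topspace P" h] by simp
  have ce: "continuous_map P Q e"
    unfolding Q_def
  proof (rule continuous_map_pullback')
    show "continuous_map P P (h \<circ> e)"
      by (rule continuous_map_eq[of P P id]) (auto simp: he)
  qed auto
  have hom: "P homeomorphic_space Q"
    unfolding homeomorphic_space_def homeomorphic_maps_def
    using ch ce he topQ by (intro exI[of _ e] exI[of _ h]) auto
  have "Polish_space Q"
    using P hom homeomorphic_completely_metrizable_space homeomorphic_separable_space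
    unfolding Polish_space_def by blast
  moreover have "continuous_map Q Z (g \<circ> h)"
    using ch g continuous_map_compose by blast
  moreover have "(g \<circ> h) ` topspace Q = A"
    using he topQ img by (auto simp: image_image)
  ultimately show ?thesis
    unfolding analytic_in_def by blast
qed

end

theory Submission
  imports Defs
begin

text \<open>
  Let \<open>x\<close> be a point of the inverse limit in the closure of \<open>A\<close>, and let \<open>A\<close> be partitioned into
  finite blocks \<open>F i\<close>. Call a set \<open>E\<close> of points of the limit positive at level \<open>k\<close> if \<open>x k\<close> lies in
  the closure of the projection of \<open>E\<close> to \<open>X k\<close>. Positivity at a level implies positivity at all
  lower levels (\<open>closure_at_lower_level\<close>), and \<open>x\<close> lies in the closure of \<open>E\<close> iff \<open>E\<close> is positive at
  every level (\<open>in_closure_of_inverse_limit_iff\<close>). The \<open>q\<^sup>+\<close> property of \<open>X k\<close> turns a union of blocks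
  that is positive at level \<open>k\<close> into a selector that is positive at level \<open>k\<close>. But one selector must
  serve all levels at once, and a union of selectors need not be a selector unless they live
  on different blocks. So everything reduces to finding pairwise disjoint sets \<open>N k\<close> of block indices
  such that the blocks indexed by \<open>N k\<close> have a union positive at level \<open>k\<close>
  (\<open>selector_from_disjoint_positive_sets\<close>).

  If every level has a positive singleton, the \<open>N k\<close> can be singletons, apart from the case that
  a single point is positive at all levels and is a selector by itself. Otherwise, from some level
  on, no block is positive. This is where analyticity enters. At each such level, the sets
  of indices whose blocks have a non-positive union form a proper ideal on the natural numbers that
  contains all finite sets. As the topology is analytic, the ideal is the projection of a closed
  set along a Polish space, so it is either meagre in the Cantor cube or comeagre in some cylinder
  (\<open>closed_projection_comeagre_somewhere\<close>). The second is impossible: flipping all coordinates above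
  the stem of the cylinder is a homeomorphism of the cylinder, so both some \<open>c\<close> and its flip would
  lie in the ideal, and together with a finite set they cover all of the natural numbers
  (\<open>meagre_analytic_ideal\<close>). Countably many meagre ideals and their images under complementation do
  not cover the cube, so some set and its complement are positive at all levels simultaneously.
  Splitting off a part again and again gives infinitely many disjoint positive sets
  (\<open>disjoint_positive_sets\<close>).
\<close>

section \<open>Meagre sets\<close>

definition meagre_in :: "'a topology \<Rightarrow> 'a set \<Rightarrow> bool" where
  "meagre_in X M \<longleftrightarrow>
     (\<exists>\<G>. countable \<G> \<and> (\<forall>T\<in>\<G>. closedin X T \<and> X interior_of T = {}) \<and> M \<subseteq> \<Union>\<G>)"

lemma meagre_in_subset: "meagre_in X M \<Longrightarrow> N \<subseteq> M \<Longrightarrow> meagre_in X N"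
  unfolding meagre_in_def by (meson subset_trans)

lemma meagre_in_closedin: "closedin X T \<Longrightarrow> X interior_of T = {} \<Longrightarrow> meagre_in X T"
  unfolding meagre_in_def by (rule exI[of _ "{T}"]) auto

lemma meagre_in_empty [simp]: "meagre_in X {}"
  unfolding meagre_in_def by (rule exI[of _ "{}"]) auto

lemma meagre_in_UN:
  assumes "countable I" and "\<And>i. i \<in> I \<Longrightarrow> meagre_in X (M i)"
  shows "meagre_in X (\<Union>i\<in>I. M i)"
proof -
  have "\<exists>\<G>. \<forall>i\<in>I. countable (\<G> i) \<and> (\<forall>T\<in>\<G> i. closedin X T \<and> X interior_of T = {}) \<and> M i \<subseteq> \<Union>(\<G> i)"
    using assms(2) unfolding meagre_in_def by (intro bchoice) blast
  then obtain \<G> where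
    \<G>: "\<forall>i\<in>I. countable (\<G> i) \<and> (\<forall>T\<in>\<G> i. closedin X T \<and> X interior_of T = {}) \<and> M i \<subseteq> \<Union>(\<G> i)"
    by blast
  have "countable (\<Union>i\<in>I. \<G> i)"
    using assms(1) \<G> by simp
  moreover have "\<forall>T\<in>\<Union>i\<in>I. \<G> i. closedin X T \<and> X interior_of T = {}"
    using \<G> by simp
  moreover have "(\<Union>i\<in>I. M i) \<subseteq> \<Union>(\<Union>i\<in>I. \<G> i)"
    using \<G> by (simp add: UN_subset_iff) (meson UN_upper Union_mono subset_trans)
  ultimately show ?thesis
    unfolding meagre_in_def by (intro exI[of _ "\<Union>i\<in>I. \<G> i"] conjI)
qed

lemma meagre_in_Un:
  assumes "meagre_in X M" and "meagre_in X N"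
  shows "meagre_in X (M \<union> N)"
proof -
  have "meagre_in X (\<Union>S\<in>{M, N}. S)"
    by (rule meagre_in_UN) (use assms in auto)
  then show ?thesis by simp
qed

lemma not_meagre_in_openin:
  assumes "completely_metrizable_space X" and "openin X U" and "U \<noteq> {}"
  shows "\<not> meagre_in X U"
proof
  assume "meagre_in X U"
  then obtain \<G> where \<G>: "countable \<G>" "\<And>T. T \<in> \<G> \<Longrightarrow> closedin X T \<and> X interior_of T = {}"
    "U \<subseteq> \<Union>\<G>"
    unfolding meagre_in_def by blast
  have "X interior_of \<Union>\<G> = {}"
    by (rule Baire_category_alt) (use assms \<G> in auto)
  then show False
    using assms(2,3) \<G>(3) interior_of_maximal[of U "\<Union>\<G>" X] by simp
qed

lemma meagre_in_homeomorphic_image: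
  assumes "homeomorphic_map X Y h" and "meagre_in X M"
  shows "meagre_in Y (h ` M)"
proof -
  obtain \<G> where \<G>: "countable \<G>" "\<And>T. T \<in> \<G> \<Longrightarrow> closedin X T \<and> X interior_of T = {}"
    "M \<subseteq> \<Union>\<G>"
    using assms(2) unfolding meagre_in_def by blast
  have "meagre_in Y (\<Union>T\<in>\<G>. h ` T)"
  proof (rule meagre_in_UN[OF \<G>(1)], rule meagre_in_closedin)
    fix T assume "T \<in> \<G>"
    then have T: "closedin X T" "X interior_of T = {}" "T \<subseteq> topspace X"
      using \<G>(2) closedin_subset by blast+
    show "closedin Y (h ` T)"
      using homeomorphic_map_closedness[OF assms(1) T(3)] T(1) by simp
    show "Y interior_of (h ` T) = {}"
      using homeomorphic_map_interior_of[OF assms(1) T(3)] T(2) by simp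
  qed
  then show ?thesis
    by (rule meagre_in_subset) (use \<G>(3) in auto)
qed

definition nonmeagre_locus :: "'a topology \<Rightarrow> 'a set \<Rightarrow> 'a set" where
  "nonmeagre_locus X M =
     {x \<in> topspace X. \<forall>U. openin X U \<and> x \<in> U \<longrightarrow> \<not> meagre_in X (M \<inter> U)}"

lemma closedin_nonmeagre_locus: "closedin X (nonmeagre_locus X M)"
proof -
  have "topspace X - nonmeagre_locus X M = \<Union>{U. openin X U \<and> meagre_in X (M \<inter> U)}"
    unfolding nonmeagre_locus_def using openin_subset by fastforce
  moreover have "openin X (\<Union>{U. openin X U \<and> meagre_in X (M \<inter> U)})"
    by (rule openin_Union) auto
  ultimately show ?thesis
    unfolding closedin_def nonmeagre_locus_def by auto
qed

lemma nonmeagre_locus_subset_closure: "nonmeagre_locus X M \<subseteq> X closure_of M"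
proof
  fix x assume x: "x \<in> nonmeagre_locus X M"
  have "\<exists>y. y \<in> M \<and> y \<in> U" if "openin X U" "x \<in> U" for U
  proof -
    have "M \<inter> U \<noteq> {}"
      using x that meagre_in_empty[of X] unfolding nonmeagre_locus_def by force
    then show ?thesis by blast
  qed
  then show "x \<in> X closure_of M"
    using x unfolding in_closure_of nonmeagre_locus_def by blast
qed

text \<open>The Banach category theorem for a second countable space: the part of \<open>M\<close> outside the locus is
covered by the countably many basic open sets in which \<open>M\<close> is meagre.\<close>

lemma meagre_in_Diff_nonmeagre_locus:
  assumes "second_countable X" and "M \<subseteq> topspace X"
  shows "meagre_in X (M - nonmeagre_locus X M)"
proof -
  obtain \<B> where \<B>: "countable \<B>"
    "\<And>U x. openin X U \<Longrightarrow> x \<in> U \<Longrightarrow> \<exists>V\<in>\<B>. x \<in> V \<and> V \<subseteq> U"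
    using assms(1) unfolding second_countable_def by metis
  have "meagre_in X (\<Union>V\<in>{V \<in> \<B>. meagre_in X (M \<inter> V)}. M \<inter> V)"
    by (rule meagre_in_UN) (use \<B>(1) in auto)
  then show ?thesis
  proof (rule meagre_in_subset, intro subsetI)
    fix x assume x: "x \<in> M - nonmeagre_locus X M"
    then obtain U where U: "openin X U" "x \<in> U" "meagre_in X (M \<inter> U)"
      using assms(2) unfolding nonmeagre_locus_def by blast
    obtain V where V: "V \<in> \<B>" "x \<in> V" "V \<subseteq> U"
      using \<B>(2) U by blast
    have "meagre_in X (M \<inter> V)"
      by (rule meagre_in_subset[OF U(3)]) (use V(3) in auto)
    then show "x \<in> (\<Union>V\<in>{V \<in> \<B>. meagre_in X (M \<inter> V)}. M \<inter> V)"
      using V x by auto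
  qed
qed

text \<open>Otherwise \<open>M \<inter> H\<close> would be covered by the meagre part of \<open>M\<close> outside the locus and by the frontier
of the locus, which is nowhere dense because the locus is closed.\<close>

lemma interior_nonmeagre_locus_meets:
  assumes "second_countable X" and "M \<subseteq> topspace X" and "\<not> meagre_in X (M \<inter> H)"
  shows "H \<inter> X interior_of nonmeagre_locus X M \<noteq> {}"
proof
  let ?L = "nonmeagre_locus X M"
  assume disj: "H \<inter> X interior_of ?L = {}"
  have fr: "X frontier_of ?L = ?L - X interior_of ?L"
    by (simp add: frontier_of_def closure_of_closedin[OF closedin_nonmeagre_locus])
  have "X interior_of (X frontier_of ?L) \<subseteq> X interior_of ?L"
    unfolding fr by (intro interior_of_mono) blast
  moreover have "X interior_of (X frontier_of ?L) \<subseteq> ?L - X interior_of ?L"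
    using interior_of_subset[of X "X frontier_of ?L"] unfolding fr .
  ultimately have "X interior_of (X frontier_of ?L) = {}"
    by blast
  then have "meagre_in X (?L - X interior_of ?L)"
    using meagre_in_closedin[OF closedin_frontier_of, of X ?L] by (simp add: fr)
  then have "meagre_in X ((M - ?L) \<union> (?L - X interior_of ?L))"
    using meagre_in_Diff_nonmeagre_locus[OF assms(1,2)] meagre_in_Un by blast
  then have "meagre_in X (M \<inter> H)"
    by (rule meagre_in_subset) (use disj in auto)
  with assms(3) show False ..
qed

section \<open>Analytic sets are meagre or comeagre somewhere\<close>

text \<open>A Souslin scheme in which \<open>J s\<close> splits into the \<open>J (s @ [j])\<close>, with the limit condition saying that
closures along a branch shrink to points of \<open>J []\<close>. Let \<open>L s\<close> be the nonmeagre locus of \<open>J s\<close>. An open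
set in which \<open>J s\<close> is nonmeagre is one in which some \<open>J (s @ [j])\<close> is nonmeagre, so the part \<open>E s\<close> of
\<open>L s\<close> that is missed by the interiors of all \<open>L (s @ [j])\<close> is nowhere dense. A point of \<open>L []\<close>
outside the countably many sets \<open>E s\<close> can therefore be followed along an infinite branch, which
puts it into \<open>J []\<close>. Hence \<open>J []\<close> is comeagre in the interior of \<open>L []\<close>.\<close>

lemma Souslin_scheme_comeagre_somewhere:
  fixes J :: "nat list \<Rightarrow> 'a set"
  assumes X: "second_countable X"
    and J: "\<And>s. J s \<subseteq> topspace X" "\<And>s. J s \<subseteq> (\<Union>j. J (s @ [j]))"
    and lim: "\<And>\<sigma> x. (\<And>n. x \<in> X closure_of J (map \<sigma> [0..<n])) \<Longrightarrow> x \<in> J []"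
    and nonmeagre: "\<not> meagre_in X (J [])"
  obtains H where "openin X H" "H \<noteq> {}" "meagre_in X (H - J [])"
proof -
  define L where "L s = nonmeagre_locus X (J s)" for s
  define E where "E s = L s - (\<Union>j. X interior_of L (s @ [j]))" for s
  have E: "meagre_in X (E s)" for s
  proof (rule meagre_in_closedin)
    have "openin X (\<Union>j. X interior_of L (s @ [j]))"
      by (rule openin_Union) auto
    then show "closedin X (E s)"
      unfolding E_def L_def using closedin_nonmeagre_locus closedin_diff by blast
    show "X interior_of E s = {}"
    proof (rule ccontr)
      let ?H = "X interior_of E s"
      assume "?H \<noteq> {}"
      then obtain z where z: "z \<in> ?H" by blast
      then have "z \<in> L s"
        using interior_of_subset[of X "E s"] unfolding E_def by blast
      then have "\<not> meagre_in X (J s \<inter> ?H)"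
        using z unfolding L_def nonmeagre_locus_def by simp
      moreover have "J s \<inter> ?H \<subseteq> (\<Union>j\<in>UNIV. J (s @ [j]) \<inter> ?H)"
        using J(2)[of s] by auto
      ultimately have "\<not> meagre_in X (\<Union>j\<in>UNIV. J (s @ [j]) \<inter> ?H)"
        using meagre_in_subset by blast
      then obtain j where "\<not> meagre_in X (J (s @ [j]) \<inter> ?H)"
        using meagre_in_UN[of UNIV X "\<lambda>j. J (s @ [j]) \<inter> ?H"] by auto
      then have "?H \<inter> X interior_of L (s @ [j]) \<noteq> {}"
        unfolding L_def by (rule interior_nonmeagre_locus_meets[OF X J(1)])
      then show False
        using interior_of_subset[of X "E s"] unfolding E_def by blast
    qed
  qed
  have "X interior_of L [] \<noteq> {}"
    using interior_nonmeagre_locus_meets[OF X J(1), of "[]" "topspace X"] nonmeagre J(1)[of "[]"]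
    unfolding L_def by (auto simp: Int_absorb2)
  moreover have "meagre_in X (X interior_of L [] - J [])"
  proof (rule meagre_in_subset)
    show "meagre_in X (\<Union>s\<in>UNIV. E s)"
      using E by (intro meagre_in_UN) auto
    show "X interior_of L [] - J [] \<subseteq> (\<Union>s\<in>UNIV. E s)"
    proof (rule subsetI, rule ccontr)
      fix x assume x: "x \<in> X interior_of L [] - J []" and nE: "x \<notin> (\<Union>s\<in>UNIV. E s)"
      have step: "\<exists>j. x \<in> L (s @ [j])" if "x \<in> L s" for s
        using nE that interior_of_subset[of X "L (s @ [_])"] unfolding E_def by blast
      have "\<exists>b. \<forall>n. (x \<in> L (b n) \<and> (n = 0 \<longrightarrow> b n = [])) \<and> (\<exists>j. b (Suc n) = b n @ [j])"
      proof (rule dependent_nat_choice)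
        show "\<exists>s. x \<in> L s \<and> ((0::nat) = 0 \<longrightarrow> s = [])"
          using x interior_of_subset[of X "L []"] by blast
      qed (use step in blast)
      then obtain b where b: "\<And>n. x \<in> L (b n)" "\<And>n. \<exists>j. b (Suc n) = b n @ [j]" "b 0 = []"
        by blast
      define \<sigma> where "\<sigma> n = last (b (Suc n))" for n
      have b_eq: "b n = map \<sigma> [0..<n]" for n
      proof (induction n)
        case (Suc n)
        obtain j where "b (Suc n) = b n @ [j]" using b(2) by blast
        then show ?case using Suc by (simp add: \<sigma>_def)
      qed (simp add: b(3))
      have "x \<in> X closure_of J (map \<sigma> [0..<n])" for n
        using b(1)[of n] nonmeagre_locus_subset_closure[of X "J (b n)"]
        unfolding L_def b_eq by blast
      then have "x \<in> J []" by (rule lim)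
      with x show False by blast
    qed
  qed
  ultimately show thesis
    using that openin_interior_of by blast
qed

text \<open>This covers all analytic sets, which are the projections of graphs of continuous functions. The
Souslin scheme refines the Polish coordinate: \<open>V s\<close> is the intersection of closed balls around
points \<open>q j\<close> of a dense sequence, with radii tending to 0. Along a branch, completeness yields a
common point \<open>p\<close> of the sets \<open>V\<close>, and if \<open>x\<close> lies in all closures of the \<open>J\<close>, then \<open>(p, x)\<close> is in the
closure of \<open>R\<close>, hence in \<open>R\<close>.\<close>

lemma closed_projection_comeagre_somewhere:
  assumes P: "Polish_space P" and X: "second_countable X"
    and R: "closedin (prod_topology P X) R" and nonmeagre: "\<not> meagre_in X (snd ` R)"
  obtains H where "openin X H" "H \<noteq> {}" "meagre_in X (H - snd ` R)"
proof -
  note result = that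
  obtain M d where "Metric_space M d" and Pd: "P = Metric_space.mtopology M d"
    and complete: "Metric_space.mcomplete M d"
    using P unfolding Polish_space_def completely_metrizable_space_def by blast
  then interpret Metric_space M d by simp
  obtain D where D: "countable D" "D \<subseteq> M" "mtopology closure_of D = M"
    using P unfolding Polish_space_def separable_space_def Pd by auto
  have R_sub: "R \<subseteq> M \<times> topspace X"
    using closedin_subset[OF R] by (simp add: Pd)
  have "R \<noteq> {}"
    using nonmeagre by auto
  then have "M \<noteq> {}"
    using R_sub by auto
  then have "D \<noteq> {}"
    using D(3) by auto
  define q where "q = from_nat_into D"
  have q: "q j \<in> M" for j
    using D(2) from_nat_into[OF \<open>D \<noteq> {}\<close>] by (auto simp: q_def)
  have dense: "\<exists>j. d (q j) p \<le> inverse (Suc n)" if "p \<in> M" for p and n :: nat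
  proof -
    have "p \<in> mtopology closure_of D"
      using D(3) that by simp
    moreover have "inverse (real (Suc n)) > 0" by simp
    ultimately obtain c where "c \<in> D" "c \<in> mball p (inverse (Suc n))"
      unfolding metric_closure_of by blast
    moreover from this obtain j where "q j = c"
      using from_nat_into_surj[OF D(1)] by (auto simp: q_def)
    ultimately show ?thesis
      using commute by (intro exI[of _ j]) (auto simp del: of_nat_Suc)
  qed
  define V where "V s = {p \<in> M. \<forall>m<length s. d (q (s ! m)) p \<le> inverse (Suc m)}" for s
  define J where "J s = snd ` (R \<inter> V s \<times> UNIV)" for s
  have J_Nil: "J [] = snd ` R"
    unfolding J_def V_def using R_sub by auto
  show thesis
  proof (rule Souslin_scheme_comeagre_somewhere[of X J])
    show "J s \<subseteq> topspace X" for s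
      unfolding J_def using R_sub by auto
    show "J s \<subseteq> (\<Union>j. J (s @ [j]))" for s
    proof
      fix c assume "c \<in> J s"
      then obtain p where p: "(p, c) \<in> R" "p \<in> V s"
        unfolding J_def by auto
      then obtain j where "d (q j) p \<le> inverse (Suc (length s))"
        using dense V_def by blast
      then have "p \<in> V (s @ [j])"
        using p(2) unfolding V_def by (auto simp: nth_append less_Suc_eq simp del: of_nat_Suc)
      then show "c \<in> (\<Union>j. J (s @ [j]))"
        unfolding J_def using p(1) by force
    qed
    show "x \<in> J []" if x: "\<And>n. x \<in> X closure_of J (map \<sigma> [0..<n])" for \<sigma> x
    proof -
      define W where "W n = V (map \<sigma> [0..<n])" for n
      have W_eq: "W n = M \<inter> (\<Inter>m\<in>{..<n}. mcball (q (\<sigma> m)) (inverse (Suc m)))" for n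
        unfolding W_def V_def using q by (auto simp: mcball_def)
      have W_Suc: "W (Suc n) \<subseteq> mcball (q (\<sigma> n)) (inverse (Suc n))" for n
        unfolding W_eq by blast
      have "\<Inter>(range W) \<noteq> {}"
      proof -
        have "closedin mtopology (W n)" for n
          unfolding W_eq by (cases n) (auto intro!: closedin_Int closedin_Inter simp del: of_nat_Suc)
        moreover have "W n \<noteq> {}" for n
        proof -
          have "J (map \<sigma> [0..<n]) \<noteq> {}"
            using x[of n] by auto
          then show ?thesis
            unfolding J_def W_def by auto
        qed
        moreover have "decseq W"
          unfolding decseq_def W_eq by auto
        moreover have "\<exists>n a. W n \<subseteq> mcball a \<epsilon>" if "\<epsilon> > 0" for \<epsilon>
        proof -
          obtain n where "inverse (real (Suc n)) < \<epsilon>"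
            using \<open>\<epsilon> > 0\<close> reals_Archimedean by blast
          then have "mcball (q (\<sigma> n)) (inverse (Suc n)) \<subseteq> mcball (q (\<sigma> n)) \<epsilon>"
            by (intro mcball_subset_concentric) simp
          then show ?thesis
            using W_Suc by blast
        qed
        ultimately show ?thesis
          using complete unfolding mcomplete_nest by blast
      qed
      then obtain p where p: "\<And>n. p \<in> W n" by blast
      then have "p \<in> M" unfolding W_eq by blast
      have xX: "x \<in> topspace X"
        using x[of 0] by (simp add: in_closure_of)
      \<comment> \<open>\<open>W (Suc n)\<close> has diameter at most \<open>2 / Suc n\<close>, so it eventually lies in any given
         neighbourhood of \<open>p\<close>.\<close>
      have "(p, x) \<in> prod_topology P X closure_of R"
        unfolding in_closure_of
      proof (intro conjI allI impI)
        show "(p, x) \<in> topspace (prod_topology P X)"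
          using \<open>p \<in> M\<close> xX by (simp add: Pd)
        fix T assume "(p, x) \<in> T \<and> openin (prod_topology P X) T"
        then obtain A B where AB: "openin P A" "openin X B" "p \<in> A" "x \<in> B" "A \<times> B \<subseteq> T"
          unfolding openin_prod_topology_alt by meson
        obtain r where r: "r > 0" "mball p r \<subseteq> A"
          using AB(1,3) unfolding Pd openin_mtopology by blast
        then obtain n where n: "inverse (real (Suc n)) < r / 2"
          using reals_Archimedean[of "r / 2"] by auto
        obtain c where "c \<in> J (map \<sigma> [0..<Suc n])" "c \<in> B"
          using x[of "Suc n"] AB(2,4) unfolding in_closure_of by blast
        then obtain p' where p': "(p', c) \<in> R" "p' \<in> W (Suc n)"
          unfolding J_def W_def by auto
        have "d (q (\<sigma> n)) p' \<le> inverse (Suc n)" "d (q (\<sigma> n)) p \<le> inverse (Suc n)" "p' \<in> M"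
          using W_Suc[of n] p' p[of "Suc n"] by auto
        moreover have "d p p' \<le> d p (q (\<sigma> n)) + d (q (\<sigma> n)) p'"
          using triangle \<open>p \<in> M\<close> \<open>p' \<in> M\<close> q by blast
        ultimately have "p' \<in> mball p r"
          using n \<open>p \<in> M\<close> commute[of p "q (\<sigma> n)"] by simp
        then show "\<exists>y. y \<in> R \<and> y \<in> T"
          using r(2) AB(5) p'(1) \<open>c \<in> B\<close> by blast
      qed
      then have "(p, x) \<in> R"
        using R by (simp add: closure_of_closedin)
      then show ?thesis
        unfolding J_Nil by force
    qed
    show "second_countable X" by (rule X)
    show "\<not> meagre_in X (J [])" using nonmeagre J_Nil by simp
    show thesis if "openin X H" "H \<noteq> {}" "meagre_in X (H - J [])" for H
      using result[of H] that unfolding J_Nil .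
  qed
qed

section \<open>Ideals in the Cantor cube\<close>

abbreviation cube :: "(nat \<Rightarrow> bool) topology" where
  "cube \<equiv> Cantor_cube UNIV"

lemma topspace_cube [simp]: "topspace cube = UNIV"
  by (simp add: Cantor_cube_def)

lemma continuous_map_cube_coordinate: "continuous_map cube (discrete_topology UNIV) (\<lambda>c. c i)"
  unfolding Cantor_cube_def by (rule continuous_map_product_projection) simp

lemma completely_metrizable_cube: "completely_metrizable_space cube"
  unfolding Cantor_cube_def completely_metrizable_space_product_topology
  by (simp add: completely_metrizable_space_discrete_topology)

lemma openin_cube_cylinder: "openin cube {c. \<forall>i<n. c i = x i}"
proof -
  have "openin cube {c \<in> topspace cube. c i \<in> {x i}}" for i
    by (rule openin_continuous_map_preimage[OF continuous_map_cube_coordinate]) simp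
  then have "openin cube (\<Inter>i\<in>{..<n}. {c \<in> topspace cube. c i \<in> {x i}})" if "n > 0"
    using that by (intro openin_Inter) auto
  moreover have "(\<Inter>i\<in>{..<n}. {c \<in> topspace cube. c i \<in> {x i}}) = {c. \<forall>i<n. c i = x i}"
    by auto
  moreover have "openin cube UNIV"
    using openin_topspace[of cube] by simp
  ultimately show ?thesis
    by (cases "n > 0") auto
qed

lemma openin_cube_contains_cylinder:
  assumes "openin cube U" and "x \<in> U"
  obtains n where "{c. \<forall>i<n. c i = x i} \<subseteq> U"
proof -
  obtain W where W: "finite {i. W i \<noteq> (UNIV :: bool set)}" "x \<in> Pi\<^sub>E UNIV W" "Pi\<^sub>E UNIV W \<subseteq> U"
    using assms unfolding Cantor_cube_def openin_product_topology_alt by auto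
  obtain n where n: "\<And>i. W i \<noteq> UNIV \<Longrightarrow> i < n"
    using W(1) finite_nat_set_iff_bounded by auto
  have "c \<in> Pi\<^sub>E UNIV W" if "\<forall>i<n. c i = x i" for c
  proof -
    have "c i \<in> W i" for i
      using that n[of i] W(2) by (cases "W i = UNIV") auto
    then show ?thesis by auto
  qed
  then have "{c. \<forall>i<n. c i = x i} \<subseteq> Pi\<^sub>E UNIV W"
    by (intro subsetI) (simp only: mem_Collect_eq)
  then show thesis
    by (rule that[OF subset_trans[OF _ W(3)]])
qed

lemma second_countable_cube: "second_countable cube"
proof -
  define cyl where "cyl l = {c. \<forall>i<length l. c i = l ! i}" for l :: "bool list"
  show ?thesis
    unfolding second_countable_def
  proof (intro exI conjI allI impI ballI)
    show "countable (range cyl)"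
      by simp
    show "openin cube V" if "V \<in> range cyl" for V
      using that openin_cube_cylinder by (auto simp: cyl_def)
    fix U x assume U: "openin cube U \<and> x \<in> U"
    then obtain n where n: "{c. \<forall>i<n. c i = x i} \<subseteq> U"
      using openin_cube_contains_cylinder by blast
    have cyl: "cyl (map x [0..<n]) = {c. \<forall>i<n. c i = x i}"
      unfolding cyl_def by (intro Collect_cong) simp
    show "\<exists>V\<in>range cyl. x \<in> V \<and> V \<subseteq> U"
    proof (intro bexI conjI)
      show "cyl (map x [0..<n]) \<subseteq> U" using n unfolding cyl .
      show "x \<in> cyl (map x [0..<n])" unfolding cyl by simp
    qed (rule rangeI)
  qed
qed

lemma homeomorphic_map_flip_above:
  "homeomorphic_map cube cube (\<lambda>c i. if i < n then c i else \<not> c i)"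
proof -
  let ?h = "\<lambda>c i. if i < n then c i else \<not> c i"
  have "continuous_map cube (discrete_topology UNIV) (\<lambda>c. ?h c i)" for i
  proof -
    have "continuous_map cube (discrete_topology UNIV) ((\<lambda>b. if i < n then b else \<not> b) \<circ> (\<lambda>c. c i))"
      by (rule continuous_map_compose[OF continuous_map_cube_coordinate]) simp
    then show ?thesis
      by (simp add: o_def)
  qed
  then have "continuous_map cube cube ?h"
    by (subst (2) Cantor_cube_def) (simp add: continuous_map_componentwise_UNIV)
  then have "homeomorphic_maps cube cube ?h ?h"
    unfolding homeomorphic_maps_def by auto
  then show ?thesis
    using homeomorphic_map_maps by blast
qed

text \<open>A form of the theorem that analytic ideals containing the finite sets are meagre. A set of indices
\<open>c\<close> is in the ideal iff some open neighbourhood of \<open>x\<close> misses all \<open>G i\<close> with \<open>i\<close> in \<open>c\<close>. Missing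
a given point is a closed condition on the characteristic function of the
neighbourhood, so the ideal is the projection of a closed set \<open>R\<close> along the Polish space that
parametrizes the topology.\<close>

lemma meagre_analytic_ideal:
  fixes G :: "nat \<Rightarrow> 'a set"
  assumes analytic: "analytic_topology X" and x: "x \<in> topspace X"
    and G: "\<And>i. G i \<subseteq> topspace X" "\<And>i. x \<notin> X closure_of G i"
    and pos: "x \<in> X closure_of (\<Union>i. G i)"
  shows "meagre_in cube {c. x \<notin> X closure_of (\<Union>i\<in>{i. c i}. G i)}" (is "meagre_in cube ?J")
proof (rule ccontr)
  assume nonmeagre: "\<not> meagre_in cube ?J"
  obtain P :: "real topology" and g where P: "Polish_space P"
    and g: "continuous_map P (Cantor_cube (topspace X)) g"
    and img: "g ` topspace P = char_fun (topspace X) ` {U. openin X U}"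
    using analytic unfolding analytic_topology_def analytic_in_def by blast
  define R where "R = {(p, c). p \<in> topspace P \<and> g p x \<and> (\<forall>i. c i \<longrightarrow> (\<forall>y\<in>G i. \<not> g p y))}"
  have "closedin (prod_topology P cube) R"
  proof -
    let ?PC = "prod_topology P cube"
    have fst: "continuous_map ?PC (discrete_topology UNIV) (\<lambda>z. g (fst z) y)" if "y \<in> topspace X" for y
    proof -
      have "continuous_map P (discrete_topology UNIV) (\<lambda>p. g p y)"
        using g that unfolding Cantor_cube_def continuous_map_componentwise by blast
      then show ?thesis
        using continuous_map_compose[OF continuous_map_fst] by (fastforce simp: o_def)
    qed
    have snd: "continuous_map ?PC (discrete_topology UNIV) (\<lambda>z. snd z i)" for i
      using continuous_map_compose[OF continuous_map_snd continuous_map_cube_coordinate]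
      by (fastforce simp: o_def)
    have cl: "closedin ?PC {z \<in> topspace ?PC. h z \<in> B}"
      if "continuous_map ?PC (discrete_topology UNIV) h" for h and B :: "bool set"
      by (rule closedin_continuous_map_preimage[OF that]) simp
    let ?K = "\<lambda>i y. {z \<in> topspace ?PC. snd z i \<in> {False}} \<union> {z \<in> topspace ?PC. g (fst z) y \<in> {False}}"
    let ?\<K> = "insert {z \<in> topspace ?PC. g (fst z) x \<in> {True}} (\<Union>i. ?K i ` G i)"
    have "closedin ?PC (\<Inter>?\<K>)"
    proof (rule closedin_Inter)
      fix K assume "K \<in> ?\<K>"
      then consider "K = {z \<in> topspace ?PC. g (fst z) x \<in> {True}}"
        | i y where "y \<in> G i" "K = ?K i y"
        by blast
      then show "closedin ?PC K"
      proof cases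
        case 1
        then show ?thesis using cl[OF fst[OF x]] by blast
      next
        case 2
        then have "y \<in> topspace X" using G(1) by blast
        then show ?thesis
          unfolding 2(2) by (intro closedin_Un cl snd fst)
      qed
    qed auto
    moreover have "\<Inter>?\<K> = R"
      unfolding R_def by fastforce
    ultimately show ?thesis by simp
  qed
  moreover have J_eq: "snd ` R = ?J"
  proof -
    have "c \<in> snd ` R \<longleftrightarrow> c \<in> ?J" for c
    proof -
      have "c \<in> snd ` R \<longleftrightarrow> (\<exists>p\<in>topspace P. g p x \<and> (\<forall>i. c i \<longrightarrow> (\<forall>y\<in>G i. \<not> g p y)))"
      proof -
        have "c \<in> snd ` R \<longleftrightarrow> (\<exists>p. (p, c) \<in> R)"
          by (simp add: image_iff Bex_def)
        then show ?thesis
          unfolding R_def by (simp only: mem_Collect_eq case_prod_conv Bex_def)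
      qed
      also have "\<dots> \<longleftrightarrow> (\<exists>u\<in>g ` topspace P. u x \<and> (\<forall>i. c i \<longrightarrow> (\<forall>y\<in>G i. \<not> u y)))"
        by (simp only: bex_simps)
      also have "\<dots> \<longleftrightarrow> (\<exists>U. openin X U \<and> char_fun (topspace X) U x
          \<and> (\<forall>i. c i \<longrightarrow> (\<forall>y\<in>G i. \<not> char_fun (topspace X) U y)))"
        unfolding img bex_simps by (simp only: Bex_def mem_Collect_eq)
      also have "\<dots> \<longleftrightarrow> (\<exists>U. openin X U \<and> x \<in> U \<and> (\<forall>i. c i \<longrightarrow> (\<forall>y\<in>G i. y \<notin> U)))"
        using x G(1) unfolding char_fun_def
        by (intro arg_cong[of _ _ Ex] ext conj_cong refl) (auto simp: subset_iff)
      also have "\<dots> \<longleftrightarrow> x \<notin> X closure_of (\<Union>i\<in>{i. c i}. G i)"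
        using x unfolding in_closure_of by blast
      finally show ?thesis by simp
    qed
    then show ?thesis by blast
  qed
  ultimately obtain H where H: "openin cube H" "H \<noteq> {}" "meagre_in cube (H - ?J)"
    using closed_projection_comeagre_somewhere[OF P second_countable_cube, of R] nonmeagre by metis
  from \<open>H \<noteq> {}\<close> obtain e where "e \<in> H" by blast
  obtain n where e: "{c. \<forall>i<n. c i = e i} \<subseteq> H"
    by (rule openin_cube_contains_cylinder[OF H(1) \<open>e \<in> H\<close>])
  \<comment> \<open>In the cylinder \<open>K\<close> the ideal is comeagre, and \<open>h\<close> maps \<open>K\<close> to itself. So by Baire's theorem some
     \<open>c\<close> in \<open>K\<close> has both \<open>c\<close> and \<open>h c\<close> in the ideal; with \<open>{..<n}\<close> they cover all indices.\<close>
  define K where "K = {c. \<forall>i<n. c i = e i}"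
  define h where "h = (\<lambda>(c :: nat \<Rightarrow> bool) i. if i < n then c i else \<not> c i)"
  have KJ: "meagre_in cube (K - ?J)"
    by (rule meagre_in_subset[OF H(3)]) (intro Diff_mono e[folded K_def] order_refl)
  have "meagre_in cube (h ` (K - ?J))"
    using meagre_in_homeomorphic_image[OF homeomorphic_map_flip_above KJ] unfolding h_def .
  then have "meagre_in cube ((K - ?J) \<union> h ` (K - ?J))"
    using KJ meagre_in_Un by blast
  moreover have "\<not> meagre_in cube K"
    using not_meagre_in_openin[OF completely_metrizable_cube openin_cube_cylinder]
    unfolding K_def by blast
  ultimately obtain c where c: "c \<in> K" "c \<notin> K - ?J" "c \<notin> h ` (K - ?J)"
    using meagre_in_subset by blast
  have hh: "h (h c) = c"
    unfolding h_def by auto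
  have "h c \<in> K"
    using c(1) unfolding K_def h_def by auto
  then have "h c \<in> ?J"
    using c(3) hh by (metis DiffI image_eqI)
  moreover have "c \<in> ?J"
    using c(1,2) by blast
  moreover have "x \<notin> X closure_of (\<Union>i\<in>{..<n}. G i)"
    using G(2) closure_of_Union[of "G ` {..<n}" X] by auto
  ultimately have "x \<notin> X closure_of
      ((\<Union>i\<in>{i. c i}. G i) \<union> (\<Union>i\<in>{i. h c i}. G i) \<union> (\<Union>i\<in>{..<n}. G i))"
    by simp
  moreover have "(\<Union>i. G i) \<subseteq>
      (\<Union>i\<in>{i. c i}. G i) \<union> (\<Union>i\<in>{i. h c i}. G i) \<union> (\<Union>i\<in>{..<n}. G i)"
  proof -
    have "c i \<or> h c i \<or> i < n" for i
      by (simp add: h_def)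
    then show ?thesis by blast
  qed
  ultimately show False
    using pos closure_of_mono by (meson subsetD)
qed

text \<open>One splitting serves all levels \<open>k\<close>: the ideals of the levels and their images under complementation
are countably many meagre sets, so by Baire's theorem some set of indices avoids all of them.\<close>

lemma split_positive_set:
  fixes G :: "nat \<Rightarrow> nat \<Rightarrow> 'a set"
  assumes "\<And>k. analytic_topology (X k)" and "\<And>k. x k \<in> topspace (X k)"
    and G: "\<And>k i. G k i \<subseteq> topspace (X k)" "\<And>k i. x k \<notin> X k closure_of G k i"
    and B: "\<And>k. x k \<in> X k closure_of (\<Union>i\<in>B. G k i)"
  obtains N where "N \<subseteq> B" "\<And>k. x k \<in> X k closure_of (\<Union>i\<in>N. G k i)"
    "\<And>k. x k \<in> X k closure_of (\<Union>i\<in>B - N. G k i)"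
proof -
  \<comment> \<open>Empty sets outside \<open>B\<close> keep the index set equal to the natural numbers.\<close>
  define G' where "G' k i = (if i \<in> B then G k i else {})" for k i
  define J where "J k = {c. x k \<notin> X k closure_of (\<Union>i\<in>{i. c i}. G' k i)}" for k
  have J: "meagre_in cube (J k)" for k
    unfolding J_def
  proof (rule meagre_analytic_ideal)
    have "(\<Union>i. G' k i) = (\<Union>i\<in>B. G k i)"
      by (auto simp: G'_def)
    then show "x k \<in> X k closure_of (\<Union>i. G' k i)"
      using B by simp
  qed (use assms in \<open>auto simp: G'_def\<close>)
  define h where "h = (\<lambda>(c :: nat \<Rightarrow> bool) i. \<not> c i)"
  have "homeomorphic_map cube cube h"
    using homeomorphic_map_flip_above[of 0] by (simp add: h_def)
  then have hJ: "meagre_in cube (h ` J k)" for k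
    using J meagre_in_homeomorphic_image by blast
  have "meagre_in cube (\<Union>k\<in>UNIV. J k \<union> h ` J k)"
    by (rule meagre_in_UN) (auto intro: meagre_in_Un J hJ)
  moreover have "\<not> meagre_in cube UNIV"
    using not_meagre_in_openin[OF completely_metrizable_cube openin_topspace] by simp
  ultimately have "(\<Union>k\<in>UNIV. J k \<union> h ` J k) \<noteq> UNIV"
    by metis
  then obtain c where "c \<notin> (\<Union>k\<in>UNIV. J k \<union> h ` J k)"
    by blast
  then have c: "\<And>k. c \<notin> J k" "\<And>k. c \<notin> h ` J k"
    by simp_all
  have "h (h c) = c"
    unfolding h_def by simp
  then have "h c \<notin> J k" for k
    using c(2) by (metis image_eqI)
  moreover have "(\<Union>i\<in>{i. c i}. G' k i) = (\<Union>i\<in>{i \<in> B. c i}. G k i)"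
    "(\<Union>i\<in>{i. h c i}. G' k i) = (\<Union>i\<in>B - {i \<in> B. c i}. G k i)" for k
    by (auto simp: G'_def h_def split: if_splits)
  ultimately have "x k \<in> X k closure_of (\<Union>i\<in>{i \<in> B. c i}. G k i)"
    "x k \<in> X k closure_of (\<Union>i\<in>B - {i \<in> B. c i}. G k i)" for k
    using c(1) unfolding J_def by simp_all
  then show thesis
    by (intro that[of "{i \<in> B. c i}"]) auto
qed

lemma disjoint_positive_sets:
  fixes G :: "nat \<Rightarrow> nat \<Rightarrow> 'a set"
  assumes X: "\<And>k. analytic_topology (X k)" and x: "\<And>k. x k \<in> topspace (X k)"
    and G: "\<And>k i. G k i \<subseteq> topspace (X k)" "\<And>k i. x k \<notin> X k closure_of G k i"
    and pos: "\<And>k. x k \<in> X k closure_of (\<Union>i. G k i)"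
  obtains N :: "nat \<Rightarrow> nat set" where "disjoint_family N" "\<And>j k. x k \<in> X k closure_of (\<Union>i\<in>N j. G k i)"
proof -
  \<comment> \<open>A decreasing sequence \<open>B\<close> of positive sets with positive differences.\<close>
  define pos where "pos B \<longleftrightarrow> (\<forall>k. x k \<in> X k closure_of (\<Union>i\<in>B. G k i))" for B
  have "\<exists>B. \<forall>n. pos (B n) \<and> (B (Suc n) \<subseteq> B n \<and> pos (B n - B (Suc n)))"
  proof (rule dependent_nat_choice)
    show "\<exists>B. pos B"
      using pos unfolding pos_def by blast
    show "\<exists>N. pos N \<and> (N \<subseteq> B \<and> pos (B - N))" if "pos B" for B
      using split_positive_set[of X x G B] X x G that unfolding pos_def by metis
  qed
  then obtain B where B: "\<And>n. B (Suc n) \<subseteq> B n" "\<And>n. pos (B n - B (Suc n))"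
    by blast
  have "decseq B"
    using B(1) by (rule decseq_SucI)
  have "B j \<subseteq> B (Suc i)" if "i < j" for i j
    using \<open>decseq B\<close> that by (simp add: decseqD)
  then have "(B i - B (Suc i)) \<inter> (B j - B (Suc j)) = {}" if "i < j" for i j
    using that by blast
  then have "disjoint_family (\<lambda>n. B n - B (Suc n))"
    unfolding disjoint_family_on_def by (metis Int_commute linorder_neqE_nat)
  then show thesis
    by (rule that) (use B(2) in \<open>simp add: pos_def\<close>)
qed

section \<open>The inverse limit\<close>

text \<open>The images of the blocks under \<open>\<pi>\<close> are finite but may overlap, so the \<open>q\<^sup>+\<close> property is applied to
the partition obtained by assigning each point of \<open>\<pi> ` A\<close> to the first block that hits it. Every
selected point is then lifted into the block to which it is assigned, so that different lifts lie
in different blocks.\<close>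

lemma q_plus_selector_along_map:
  fixes F :: "nat \<Rightarrow> 'b set" and \<pi> :: "'b \<Rightarrow> 'a"
  assumes X: "q_plus_space X" and "A \<subseteq> \<pi> -` topspace X"
    and F: "disjoint_family F" "(\<Union>n. F n) = A" "\<And>n. finite (F n)"
    and z: "z \<in> X closure_of (\<pi> ` A)"
  obtains S where "S \<subseteq> A" "z \<in> X closure_of (\<pi> ` S)" "\<And>n. card (S \<inter> F n) \<le> 1"
proof -
  define D where "D = disjointed (\<lambda>n. \<pi> ` F n)"
  have D: "disjoint_family D" "\<And>n. D n \<subseteq> \<pi> ` F n"
    unfolding D_def by (rule disjoint_family_disjointed, rule disjointed_subset)
  have D_Un: "(\<Union>n. D n) = \<pi> ` A"
    unfolding D_def UN_disjointed_eq using F(2) by blast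
  have "finite (D n)" for n
    using D(2) F(3) by (meson finite_imageI finite_subset)
  then obtain T where T: "T \<subseteq> \<pi> ` A" "z \<in> X closure_of T" "\<And>n. card (T \<inter> D n) \<le> 1"
    using X[unfolded q_plus_space_def, rule_format, of "\<pi> ` A" z D] D(1) D_Un assms(2) z
    by (auto simp: image_subset_iff_subset_vimage)
  have "\<forall>t\<in>T. \<exists>y. \<exists>n. y \<in> F n \<and> t \<in> D n \<and> \<pi> y = t"
    using T(1) D(2) unfolding D_Un[symmetric] by blast
  then obtain y where y: "\<And>t. t \<in> T \<Longrightarrow> \<exists>n. y t \<in> F n \<and> t \<in> D n \<and> \<pi> (y t) = t"
    by metis
  show thesis
  proof
    show "y ` T \<subseteq> A"
      using y F(2) by blast
    have "\<pi> ` y ` T = T"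
      using y by force
    then show "z \<in> X closure_of (\<pi> ` y ` T)"
      using T(2) by simp
    show "card (y ` T \<inter> F n) \<le> 1" for n
    proof -
      have "y ` T \<inter> F n \<subseteq> y ` (T \<inter> D n)"
      proof
        fix v assume "v \<in> y ` T \<inter> F n"
        then obtain t where t: "t \<in> T" "v = y t" "y t \<in> F n" by blast
        then obtain m where "y t \<in> F m" "t \<in> D m" using y by blast
        moreover from this have "m = n"
          using F(1) t(3) unfolding disjoint_family_on_def by (metis UNIV_I disjoint_iff)
        ultimately show "v \<in> y ` (T \<inter> D n)"
          using t by blast
      qed
      moreover have fin: "finite (T \<inter> D n)"
        using \<open>finite (D n)\<close> by blast
      ultimately have "card (y ` T \<inter> F n) \<le> card (T \<inter> D n)"
        using card_mono card_image_le by (meson finite_imageI le_trans)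
      then show ?thesis
        using T(3)[of n] by linarith
    qed
  qed
qed

lemma in_topspace_inverse_limit:
  assumes "y \<in> topspace (inverse_limit X f)"
  shows "y n \<in> topspace (X n)" and "y n = f n (y (Suc n))"
proof -
  have y: "y \<in> topspace (product_topology X UNIV)" "y \<in> {x. \<forall>n. x n = f n (x (Suc n))}"
    using assms unfolding inverse_limit_def topspace_subtopology by (blast, blast)
  show "y n \<in> topspace (X n)"
    using PiE_mem[OF y(1)[unfolded topspace_product_topology] UNIV_I] by simp
  show "y n = f n (y (Suc n))"
    using y(2) unfolding mem_Collect_eq by blast
qed

text \<open>In a product this fails: the closure is not determined by the single coordinates. In the inverse
limit a basic neighbourhood restricts only coordinates below some \<open>n\<close>, and the bonding maps pull
these restrictions back to one open set of \<open>X n\<close>.\<close>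

lemma in_closure_of_inverse_limit_iff:
  assumes f: "inverse_sequence X f" and x: "x \<in> topspace (inverse_limit X f)"
    and E: "E \<subseteq> topspace (inverse_limit X f)"
  shows "x \<in> inverse_limit X f closure_of E \<longleftrightarrow> (\<forall>n. x n \<in> X n closure_of ((\<lambda>y. y n) ` E))"
    (is "?l \<longleftrightarrow> ?r")
proof
  have proj: "continuous_map (inverse_limit X f) (X n) (\<lambda>y. y n)" for n
    unfolding inverse_limit_def
    by (intro continuous_map_from_subtopology continuous_map_product_projection) simp
  then show ?r if ?l
  proof (intro allI)
    fix n
    have "(\<lambda>y. y n) x \<in> X n closure_of ((\<lambda>y. y n) ` E)"
      by (rule subsetD[OF continuous_map_image_closure_subset[OF proj] imageI[OF that]])
    then show "x n \<in> X n closure_of ((\<lambda>y. y n) ` E)" .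
  qed
next
  assume r: ?r
  note pt = in_topspace_inverse_limit
  show ?l
    unfolding in_closure_of
  proof (intro conjI x allI impI)
    fix T assume T: "x \<in> T \<and> openin (inverse_limit X f) T"
    then obtain T' where T': "openin (product_topology X UNIV) T'"
      "T = T' \<inter> {x. \<forall>n. x n = f n (x (Suc n))}"
      unfolding inverse_limit_def openin_subtopology by blast
    have "x \<in> T'"
      using T T'(2) by blast
    then obtain W where W: "finite {i. W i \<noteq> topspace (X i)}" "\<And>i. openin (X i) (W i)"
      "x \<in> Pi\<^sub>E UNIV W" "Pi\<^sub>E UNIV W \<subseteq> T'"
      using bspec[OF T'(1)[unfolded openin_product_topology_alt] \<open>x \<in> T'\<close>]
      by (auto simp: conj_assoc simp del: PiE_UNIV_domain)
    obtain n where n: "\<And>i. W i \<noteq> topspace (X i) \<Longrightarrow> i < n"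
      using W(1) finite_nat_set_iff_bounded by auto
    \<comment> \<open>\<open>W i\<close> is the whole space from \<open>n\<close> on, so only the restrictions below \<open>n\<close> are pulled back.\<close>
    have "\<exists>V. openin (X m) V \<and> x m \<in> V \<and>
        (\<forall>y\<in>topspace (inverse_limit X f). y m \<in> V \<longrightarrow> (\<forall>i<m. y i \<in> W i))" for m
    proof (induction m)
      case 0
      have "x 0 \<in> topspace (X 0)"
        by (rule pt(1)[OF x])
      then show ?case
        by (intro exI[of _ "topspace (X 0)"]) auto
    next
      case (Suc m)
      then obtain V where V: "openin (X m) V" "x m \<in> V"
        "\<forall>y\<in>topspace (inverse_limit X f). y m \<in> V \<longrightarrow> (\<forall>i<m. y i \<in> W i)"
        by blast
      let ?V = "{z \<in> topspace (X (Suc m)). f m z \<in> V \<inter> W m}"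
      have "openin (X (Suc m)) ?V"
      proof (rule openin_continuous_map_preimage)
        show "continuous_map (X (Suc m)) (X m) (f m)"
          using f unfolding inverse_sequence_def by blast
        show "openin (X m) (V \<inter> W m)"
          using V(1) W(2) by blast
      qed
      moreover have "x (Suc m) \<in> ?V"
      proof -
        have "x m \<in> W m" using W(3) by auto
        moreover have "x m = f m (x (Suc m))" by (rule pt(2)[OF x])
        ultimately show ?thesis using V(2) pt(1)[OF x, of "Suc m"] by simp
      qed
      moreover have "\<forall>i<Suc m. y i \<in> W i"
        if y: "y \<in> topspace (inverse_limit X f)" "y (Suc m) \<in> ?V" for y
      proof -
        have "y m \<in> V \<inter> W m"
          using pt(2)[OF y(1), of m] y(2) by auto
        then show ?thesis
          using V(3) y(1) by (auto simp: less_Suc_eq)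
      qed
      ultimately show ?case by blast
    qed
    then obtain V where V: "openin (X n) V" "x n \<in> V"
      "\<forall>y\<in>topspace (inverse_limit X f). y n \<in> V \<longrightarrow> (\<forall>i<n. y i \<in> W i)"
      by blast
    obtain y where y: "y \<in> E" "y n \<in> V"
      using r V(1,2) unfolding in_closure_of by blast
    then have yl: "y \<in> topspace (inverse_limit X f)"
      using E by blast
    have "y i \<in> W i" for i
      using V(3) yl y(2) n[of i] pt(1)[OF yl, of i] by (cases "W i = topspace (X i)") auto
    then have "y \<in> T'"
      by (intro subsetD[OF W(4)] PiE_I) auto
    moreover have "\<forall>n. y n = f n (y (Suc n))"
      using pt(2)[OF yl] by blast
    ultimately show "\<exists>y. y \<in> E \<and> y \<in> T"
      using y(1) unfolding T'(2) by blast
  qed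
qed

lemma closure_at_lower_level:
  assumes f: "inverse_sequence X f" and x: "x \<in> topspace (inverse_limit X f)"
    and E: "E \<subseteq> topspace (inverse_limit X f)" and "m \<le> n"
    and "x n \<in> X n closure_of ((\<lambda>y. y n) ` E)"
  shows "x m \<in> X m closure_of ((\<lambda>y. y m) ` E)"
  using assms(4,5)
proof (induction n rule: dec_induct)
  case (step n)
  note eq = in_topspace_inverse_limit(2)[of _ X f]
  have "f n ` (X (Suc n) closure_of ((\<lambda>y. y (Suc n)) ` E)) \<subseteq> X n closure_of (f n ` (\<lambda>y. y (Suc n)) ` E)"
    using f unfolding inverse_sequence_def by (intro continuous_map_image_closure_subset) blast
  moreover have "f n ` (\<lambda>y. y (Suc n)) ` E = (\<lambda>y. y n) ` E"
    unfolding image_image by (intro image_cong refl eq[symmetric] subsetD[OF E])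
  ultimately have "f n (x (Suc n)) \<in> X n closure_of ((\<lambda>y. y n) ` E)"
    using imageI[OF step.prems, of "f n"] by auto
  then show ?case
    unfolding eq[OF x, of n, symmetric] by (rule step.IH)
qed auto

text \<open>A selector \<open>S k\<close> taken from the blocks indexed by \<open>N k\<close> makes the union positive at level \<open>k\<close>, and the
union meets each block in at most one point because a block belongs to at most one \<open>N k\<close>.\<close>

lemma selector_from_disjoint_positive_sets:
  fixes F :: "nat \<Rightarrow> (nat \<Rightarrow> 'a) set" and N :: "nat \<Rightarrow> nat set"
  assumes f: "inverse_sequence X f" and q: "\<And>n. q_plus_space (X n)"
    and x: "x \<in> topspace (inverse_limit X f)"
    and F: "\<And>n. F n \<subseteq> topspace (inverse_limit X f)" "disjoint_family F" "\<And>n. finite (F n)"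
    and N: "disjoint_family N" "\<And>k. x k \<in> X k closure_of ((\<lambda>y. y k) ` (\<Union>i\<in>N k. F i))"
  obtains S where "S \<subseteq> (\<Union>n. F n)" "x \<in> inverse_limit X f closure_of S"
    "\<And>n. card (S \<inter> F n) \<le> 1"
proof -
  have disj: "i = n" if "y \<in> F i" "y \<in> F n" for i n y
    using F(2) that unfolding disjoint_family_on_def by (metis UNIV_I disjoint_iff)
  have disj_N: "j = k" if "n \<in> N j" "n \<in> N k" for j k n
    using N(1) that unfolding disjoint_family_on_def by (metis UNIV_I disjoint_iff)
  have "\<exists>S. S \<subseteq> (\<Union>i\<in>N k. F i) \<and> x k \<in> X k closure_of ((\<lambda>y. y k) ` S)
      \<and> (\<forall>n. card (S \<inter> F n) \<le> 1)" for k
  proof -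
    define F' where "F' n = (if n \<in> N k then F n else {})" for n
    have U: "(\<Union>n. F' n) = (\<Union>i\<in>N k. F i)"
      by (auto simp: F'_def)
    obtain S where S: "S \<subseteq> (\<Union>i\<in>N k. F i)" "x k \<in> X k closure_of ((\<lambda>y. y k) ` S)"
      "\<And>n. card (S \<inter> F' n) \<le> 1"
    proof (rule q_plus_selector_along_map[OF q, of "\<Union>i\<in>N k. F i" "\<lambda>y. y k" k F'])
      show "(\<Union>i\<in>N k. F i) \<subseteq> (\<lambda>y. y k) -` topspace (X k)"
        using F(1) in_topspace_inverse_limit(1) by blast
      show "disjoint_family F'"
        using F(2) unfolding disjoint_family_on_def F'_def by auto
    qed (use F(3) N(2) U in \<open>auto simp: F'_def\<close>)
    have "card (S \<inter> F n) \<le> 1" for n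
    proof (cases "n \<in> N k")
      case True
      then show ?thesis using S(3)[of n] by (simp add: F'_def)
    next
      case False
      then have "S \<inter> F n = {}"
        using S(1) disj[of _ _ n] by blast
      then show ?thesis by simp
    qed
    with S show ?thesis by blast
  qed
  then obtain S where S: "\<And>k. S k \<subseteq> (\<Union>i\<in>N k. F i)"
    "\<And>k. x k \<in> X k closure_of ((\<lambda>y. y k) ` S k)" "\<And>k n. card (S k \<inter> F n) \<le> 1"
    by metis
  show thesis
  proof
    show sub: "(\<Union>k. S k) \<subseteq> (\<Union>n. F n)"
      using S(1) by blast
    have "x k \<in> X k closure_of ((\<lambda>y. y k) ` (\<Union>k. S k))" for k
      by (rule subsetD[OF closure_of_mono[OF image_mono] S(2)]) blast
    then show "x \<in> inverse_limit X f closure_of (\<Union>k. S k)"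
      using in_closure_of_inverse_limit_iff[OF f x, of "\<Union>k. S k"] sub F(1) by blast
    show "card ((\<Union>k. S k) \<inter> F n) \<le> 1" for n
    proof -
      have only: "n \<in> N k" if "S k \<inter> F n \<noteq> {}" for k
        using that S(1)[of k] disj[of _ _ n] by blast
      show ?thesis
      proof (cases "\<exists>k. n \<in> N k")
        case True
        then obtain k where "n \<in> N k" by blast
        then have "S k' \<inter> F n \<subseteq> S k" for k'
          using only[of k'] disj_N[of n k' k] by (cases "k' = k") auto
        then have "(\<Union>k. S k) \<inter> F n = S k \<inter> F n"
          by fast
        then show ?thesis using S(3) by simp
      next
        case False
        then have "(\<Union>k. S k) \<inter> F n = {}"
          using only by blast
        then show ?thesis by simp
      qed
    qed
  qed
qed

text \<open>The three cases differ in how single points accumulate at \<open>x\<close>: one point may do so at all levels,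
or at each level some point does, or from a level \<open>l\<close> on no point does. Only in the last case do the
ideals of the levels contain all finite sets, and then the levels below \<open>l\<close> are skipped.\<close>

lemma inverse_limit_selector:
  fixes F :: "nat \<Rightarrow> (nat \<Rightarrow> 'a) set"
  assumes f: "inverse_sequence X f" and analytic: "\<And>n. analytic_topology (X n)"
    and q: "\<And>n. q_plus_space (X n)"
    and xA: "x \<in> inverse_limit X f closure_of (\<Union>n. F n)"
    and F: "\<And>n. F n \<subseteq> topspace (inverse_limit X f)" "disjoint_family F" "\<And>n. finite (F n)"
  obtains S where "S \<subseteq> (\<Union>n. F n)" "x \<in> inverse_limit X f closure_of S"
    "\<And>n. card (S \<inter> F n) \<le> 1"
proof -
  define A where "A = (\<Union>n. F n)"
  define pos where "pos k E \<longleftrightarrow> x k \<in> X k closure_of ((\<lambda>y. y k) ` E)" for k and E :: "(nat \<Rightarrow> 'a) set"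
  have x: "x \<in> topspace (inverse_limit X f)"
    using xA by (simp add: in_closure_of)
  have A: "A \<subseteq> topspace (inverse_limit X f)"
    using F(1) by (auto simp: A_def)
  have lower: "pos m E" if "pos n E" "m \<le> n" "E \<subseteq> A" for m n E
    using that closure_at_lower_level[OF f x] A unfolding pos_def by blast
  have posA: "pos k A" for k
    using in_closure_of_inverse_limit_iff[OF f x A] xA unfolding pos_def A_def by blast
  note result = that
  have finish: thesis if "disjoint_family N" "\<And>k. pos k (\<Union>i\<in>N k. F i)" for N :: "nat \<Rightarrow> nat set"
    using selector_from_disjoint_positive_sets[OF f q x F that(1)] that(2) result
    unfolding pos_def by metis
  consider (point) y where "y \<in> A" "\<And>k. pos k {y}"
    | (points) "\<And>y. y \<in> A \<Longrightarrow> \<exists>k. \<not> pos k {y}" "\<And>k. \<exists>y\<in>A. pos k {y}"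
    | (null) l where "\<And>y. y \<in> A \<Longrightarrow> \<not> pos l {y}"
    by blast
  then show thesis
  proof cases
    case point
    have "card ({y} \<inter> F n) \<le> 1" for n
      using card_mono[of "{y}" "{y} \<inter> F n"] by simp
    moreover have "x \<in> inverse_limit X f closure_of {y}"
      using in_closure_of_inverse_limit_iff[OF f x, of "{y}"] point A unfolding pos_def by blast
    ultimately show thesis
      using that[of "{y}"] point(1) unfolding A_def by blast
  next
    case points
    \<comment> \<open>The sets \<open>B k\<close> decrease with \<open>k\<close>, none is empty, and no block belongs to all of them because
       each of its finitely many points is non-positive from some level on. So all are infinite, and distinct indices can be picked from them.\<close>
    define B where "B k = {i. \<exists>y\<in>F i. pos k {y}}" for k
    have B_anti: "B n \<subseteq> B m" if "m \<le> n" for m n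
      using lower that unfolding B_def A_def by blast
    have "infinite (B k)" for k
    proof
      assume "finite (B k)"
      then have "finite (\<Union>i\<in>B k. F i)"
        using F(3) by blast
      moreover obtain l where l: "\<And>y. y \<in> A \<Longrightarrow> \<not> pos (l y) {y}"
        using points(1) by metis
      ultimately obtain m where m: "\<And>y. y \<in> (\<Union>i\<in>B k. F i) \<Longrightarrow> l y \<le> m"
        by (metis finite_imageI finite_nat_set_iff_bounded_le imageI)
      obtain y where y: "y \<in> A" "pos (max k m) {y}"
        using points(2) by blast
      then obtain i where i: "y \<in> F i" "i \<in> B (max k m)"
        unfolding A_def B_def by blast
      then have "l y \<le> m"
        using m B_anti[of k "max k m"] by fastforce
      then have "pos (l y) {y}"
        using lower[OF y(2)] y(1) by auto
      with l y(1) show False by blast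
    qed
    then have "\<exists>i. \<forall>n. i n \<in> B n \<and> i n < i (Suc n)"
      by (intro dependent_nat_choice) (auto simp: infinite_nat_iff_unbounded dest: not_finite_existsD)
    then obtain i where i: "\<And>n. i n \<in> B n" "\<And>n. i n < i (Suc n)"
      by blast
    then have "inj i"
      by (simp add: strict_mono_Suc_iff strict_mono_imp_inj_on)
    then have "disjoint_family (\<lambda>k. {i k})"
      unfolding disjoint_family_on_def by (auto dest: injD)
    moreover have "pos k (\<Union>j\<in>{i k}. F j)" for k
    proof -
      obtain y where y: "y \<in> F (i k)" "pos k {y}"
        using i(1)[of k] unfolding B_def by blast
      then show ?thesis
        unfolding pos_def using y(1)
        by (intro subsetD[OF closure_of_mono[OF image_mono] y(2)[unfolded pos_def]]) simp
    qed
    ultimately show thesis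
      by (rule finish)
  next
    case null
    have F_null: "\<not> pos (k + l) (F i)" for k i
    proof -
      have "\<not> pos (k + l) {y}" if "y \<in> F i" for y
        using null[of y] lower[of "k + l" "{y}" l] that unfolding A_def by auto
      then show ?thesis
        using closure_of_Union[of "(\<lambda>y. {y (k + l)}) ` F i" "X (k + l)"] F(3)[of i]
        unfolding pos_def by (simp add: UNION_singleton_eq_range)
    qed
    obtain N :: "nat \<Rightarrow> nat set" where N: "disjoint_family N"
      "\<And>j k. x (k + l) \<in> X (k + l) closure_of (\<Union>i\<in>N j. (\<lambda>y. y (k + l)) ` F i)"
    proof (rule disjoint_positive_sets[of "\<lambda>k. X (k + l)" "\<lambda>k. x (k + l)"
          "\<lambda>k i. (\<lambda>y. y (k + l)) ` F i"])
      show "x (k + l) \<in> topspace (X (k + l))" for k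
        by (rule in_topspace_inverse_limit(1)[OF x])
      show "(\<lambda>y. y (k + l)) ` F i \<subseteq> topspace (X (k + l))" for k i
        using in_topspace_inverse_limit(1) F(1) by blast
      show "x (k + l) \<notin> X (k + l) closure_of (\<lambda>y. y (k + l)) ` F i" for k i
        using F_null unfolding pos_def .
      show "x (k + l) \<in> X (k + l) closure_of (\<Union>i. (\<lambda>y. y (k + l)) ` F i)" for k
        using posA[of "k + l"] unfolding pos_def A_def by (simp add: image_UN)
    qed (use analytic in auto)
    have "pos (k + l) (\<Union>i\<in>N k. F i)" for k
      using N(2)[of k k] unfolding pos_def by (simp add: image_UN)
    then have "pos k (\<Union>i\<in>N k. F i)" for k
      by (rule lower) (auto simp: A_def)
    with N(1) show thesis
      by (rule finish)
  qed
qed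

theorem theorem3p5:
  fixes X :: "nat \<Rightarrow> 'a topology" and f :: "nat \<Rightarrow> 'a \<Rightarrow> 'a"
  assumes "inverse_sequence X f"
    and "\<And>n. countable (topspace (X n))"
    and "\<And>n. analytic_topology (X n)"
    and "\<And>n. q_plus_space (X n)"
  shows "\<forall>Y. Y \<subseteq> topspace (inverse_limit X f) \<and> countable Y \<longrightarrow>
           q_plus_space (subtopology (inverse_limit X f) Y)"
proof (intro allI impI)
  fix Y assume Y: "Y \<subseteq> topspace (inverse_limit X f) \<and> countable Y"
  have cl: "subtopology (inverse_limit X f) Y closure_of S = Y \<inter> inverse_limit X f closure_of S"
    if "S \<subseteq> Y" for S
    using that by (simp add: closure_of_subtopology Int_absorb1)
  show "q_plus_space (subtopology (inverse_limit X f) Y)"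
    unfolding q_plus_space_def
  proof (intro allI impI, elim conjE)
    fix A x and F :: "nat \<Rightarrow> (nat \<Rightarrow> 'a) set"
    assume A: "A \<subseteq> topspace (subtopology (inverse_limit X f) Y)"
      and xA: "x \<in> subtopology (inverse_limit X f) Y closure_of A"
      and F: "disjoint_family F" "(\<Union>n. F n) = A" "\<forall>n. finite (F n)"
    have AY: "A \<subseteq> Y" using A by simp
    obtain S where S: "S \<subseteq> (\<Union>n. F n)" "x \<in> inverse_limit X f closure_of S"
      "\<And>n. card (S \<inter> F n) \<le> 1"
    proof (rule inverse_limit_selector[OF assms(1,3,4), of x F])
      show "x \<in> inverse_limit X f closure_of (\<Union>n. F n)"
        using xA cl[OF AY] F(2) by blast
      show "F n \<subseteq> topspace (inverse_limit X f)" for n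
        using A F(2) by auto
    qed (use F in auto)
    have "S \<subseteq> A"
      using S(1) unfolding F(2) .
    moreover have "x \<in> subtopology (inverse_limit X f) Y closure_of S"
      unfolding cl[OF subset_trans[OF \<open>S \<subseteq> A\<close> AY]]
      using S(2) xA[unfolded cl[OF AY]] by blast
    ultimately show "\<exists>S\<subseteq>A. x \<in> subtopology (inverse_limit X f) Y closure_of S \<and>
        (\<forall>n. card (S \<inter> F n) \<le> 1)"
      using S(3) by (intro exI[of _ S] conjI allI)
  qed
qed

end
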